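(* Let $X$ be an infinite set, let $K_X$ be the complete graph with vertex set $X$, let $e_0=\{x_0,x_1\}$ be an edge of $K_X$, and let $K_X'$ be the graph obtained from $K_X$ by deleting the edge $e_0$ (keeping the vertex set $X$). Then: (i) $\chi(K_X)=\chi(K_X')=\#X$; (ii) $\#\underline{\chi}(K_X,X)=\#\underline{\chi}(K_X',X)=2^{\#X}$; (iii) $K_X$ and $K_X'$ are not chromatically equivalent, i.e. $\underline{\chi}(K_X,\bullet)$ and $\underline{\chi}(K_X',\bullet)$ are not isomorphic as functors $\mathbf{Set}^{\mathrm{inj}}\to\mathbf{Set}^{\mathrm{inj}}$.
   Context: A simple graph $G=(V,E)$ consists of a set $V$ of vertices and a set $E$ of unoriented edges, each edge being a two-element subset of $V$. The complete graph $K_X$ has vertex set $X$ and all two-element subsets of $X$ as edges. For a set $Z$, $\underline{\chi}(G,Z)=\{c:V\to Z\mid \{v_1,v_2\}\in E\Rightarrow c(v_1)\neq c(v_2)\}$. The chromatic number $\chi(G)$ is the minimum cardinality of a set $Z$ with $\underline{\chi}(G,Z)\neq\emptyset$. $\mathbf{Set}^{\mathrm{inj}}$ denotes the category of sets and injective maps. The chromatic functor $\underline{\chi}(G,\bullet):\mathbf{Set}^{\mathrm{inj}}\to\mathbf{Set}^{\mathrm{inj}}$ sends $Z$ to $\underline{\chi}(G,Z)$ and an injection $f:Z\to W$ to $f_*:c\mapsto f\circ c$. Two graphs are chromatically equivalent if their chromatic functors are naturally isomorphic. *)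

theory Defs
  imports Main "HOL-Library.FuncSet"
begin

unbundle cardinal_syntax

record 'v graph =
  verts :: "'v set"
  edges :: "'v set set"

definition simple_graph :: "'v graph \<Rightarrow> bool" where
  "simple_graph G \<longleftrightarrow> (\<forall>e\<in>edges G. e \<subseteq> verts G \<and> card e = 2)"

definition complete_graph :: "'v set \<Rightarrow> 'v graph" where
  "complete_graph X = \<lparr>verts = X, edges = {e. e \<subseteq> X \<and> card e = 2}\<rparr>"

definition delete_edge :: "'v graph \<Rightarrow> 'v set \<Rightarrow> 'v graph" where
  "delete_edge G e = \<lparr>verts = verts G, edges = edges G - {e}\<rparr>"

lemma simple_graph_complete_graph: "simple_graph (complete_graph X)"
  by (simp add: simple_graph_def complete_graph_def)

lemma simple_graph_delete_edge: "simple_graph G \<Longrightarrow> simple_graph (delete_edge G e)"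
  by (simp add: simple_graph_def delete_edge_def)

text \<open>Maps out of a set are extensional functions, so that a map from
  \<open>verts G\<close> to \<open>Z\<close> is represented by exactly one HOL function;
  this matters when colourings are counted.\<close>

definition colorings :: "'v graph \<Rightarrow> 'z set \<Rightarrow> ('v \<Rightarrow> 'z) set" where
  "colorings G Z =
     {c \<in> verts G \<rightarrow>\<^sub>E Z. \<forall>v1 v2. {v1, v2} \<in> edges G \<longrightarrow> c v1 \<noteq> c v2}"

text \<open>The sets considered are the subsets of a type \<open>'z\<close>. Cardinals are the
  library's cardinal orders, determined up to \<open>=o\<close>; the minimum is with respect to \<open>\<le>o\<close>.
  If \<open>'z\<close> is too small to contain any set of colours for \<open>G\<close>, the value is unspecified;
  by \<open>chromatic_number_attained\<close> the minimum is otherwise attained, and by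
  \<open>chromatic_number_universe_independent\<close> it does not depend on \<open>'z\<close> as soon as \<open>'z\<close> contains a copy of the vertex set.\<close>

definition chromatic_number :: "'z itself \<Rightarrow> 'v graph \<Rightarrow> 'z rel" where
  "chromatic_number TYPE('z) G =
     (SOME \<kappa>. \<exists>Z::'z set. \<kappa> = |Z| \<and> colorings G Z \<noteq> {} \<and>
        (\<forall>W::'z set. colorings G W \<noteq> {} \<longrightarrow> |Z| \<le>o |W| ))"

lemma chromatic_number_attained:
  fixes G :: "'v graph"
  assumes "colorings G (Y::'z set) \<noteq> {}"
  shows "\<exists>Z::'z set. chromatic_number TYPE('z) G = |Z| \<and> colorings G Z \<noteq> {} \<and>
           (\<forall>W::'z set. colorings G W \<noteq> {} \<longrightarrow> |Z| \<le>o |W| )"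
proof -
  let ?R = "{|Z| | Z::'z set. colorings G Z \<noteq> {}}"
  have "\<exists>r\<in>?R. \<forall>r'\<in>?R. r \<le>o r'"
    using assms by (intro exists_minim_Card_order) (auto simp: card_of_Card_order)
  then have "\<exists>\<kappa>. \<exists>Z::'z set. \<kappa> = |Z| \<and> colorings G Z \<noteq> {} \<and>
        (\<forall>W::'z set. colorings G W \<noteq> {} \<longrightarrow> |Z| \<le>o |W| )"
    by blast
  then show ?thesis
    unfolding chromatic_number_def by (rule someI_ex)
qed

lemma colorings_transport:
  fixes G :: "'v graph" and Z :: "'y set"
  assumes "simple_graph G" and "|verts G| \<le>o |UNIV :: 'z set|" and "colorings G Z \<noteq> {}"
  shows "\<exists>W::'z set. colorings G W \<noteq> {} \<and> |W| \<le>o |Z|"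
proof -
  obtain c where c: "c \<in> colorings G Z" using assms(3) by blast
  have "|c ` verts G| \<le>o |UNIV :: 'z set|"
    using card_of_image assms(2) by (rule ordLeq_transitive)
  then obtain g :: "'y \<Rightarrow> 'z" where g: "inj_on g (c ` verts G)"
    by (auto simp: card_of_ordLeq[symmetric])
  let ?W = "g ` c ` verts G"
  have "compose (verts G) g c \<in> colorings G ?W"
    unfolding colorings_def
  proof (intro CollectI conjI allI impI)
    show "compose (verts G) g c \<in> verts G \<rightarrow>\<^sub>E ?W"
      by (auto simp: compose_def)
    fix v1 v2 assume e: "{v1, v2} \<in> edges G"
    then have "v1 \<in> verts G" "v2 \<in> verts G" using assms(1) by (auto simp: simple_graph_def)
    moreover have "c v1 \<noteq> c v2" using c e by (auto simp: colorings_def)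
    ultimately show "compose (verts G) g c v1 \<noteq> compose (verts G) g c v2"
      using g by (auto simp: compose_def dest: inj_onD)
  qed
  moreover have "c ` verts G \<subseteq> Z" using c by (auto simp: colorings_def)
  then have "|?W| \<le>o |Z|"
    by (intro ordLeq_transitive[OF card_of_image] card_of_mono1)
  ultimately show ?thesis by blast
qed

lemma chromatic_number_universe_independent:
  fixes G :: "'v graph"
  assumes G: "simple_graph G"
    and y: "|verts G| \<le>o |UNIV :: 'y set|" and z: "|verts G| \<le>o |UNIV :: 'z set|"
  shows "chromatic_number TYPE('y) G =o chromatic_number TYPE('z) G"
proof -
  have "restrict id (verts G) \<in> colorings G (verts G)"
    using G by (fastforce simp: colorings_def simple_graph_def)
  then have ne: "colorings G (verts G) \<noteq> {}" by blast
  obtain Y where Y: "chromatic_number TYPE('y) G = |Y|" "colorings G Y \<noteq> {}"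
      "\<And>W::'y set. colorings G W \<noteq> {} \<Longrightarrow> |Y| \<le>o |W|"
    using colorings_transport[OF G y ne] chromatic_number_attained by metis
  obtain Z where Z: "chromatic_number TYPE('z) G = |Z|" "colorings G Z \<noteq> {}"
      "\<And>W::'z set. colorings G W \<noteq> {} \<Longrightarrow> |Z| \<le>o |W|"
    using colorings_transport[OF G z ne] chromatic_number_attained by metis
  have "|Y| \<le>o |Z|"
    using colorings_transport[OF G y Z(2)] Y(3) ordLeq_transitive by blast
  moreover have "|Z| \<le>o |Y|"
    using colorings_transport[OF G z Y(2)] Z(3) ordLeq_transitive by blast
  ultimately show ?thesis using Y(1) Z(1) by (simp add: ordIso_iff_ordLeq)
qed

definition inj_hom :: "'a set \<Rightarrow> 'b set \<Rightarrow> ('a \<Rightarrow> 'b) set" where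
  "inj_hom Z W = {f \<in> Z \<rightarrow>\<^sub>E W. inj_on f Z}"

text \<open>A functor from the category of subsets of \<open>'z\<close> and injections to the category of
  subsets of \<open>'x\<close> and injections; \<open>arr F Z W f\<close> is the image of \<open>f \<in> inj_hom Z W\<close>.\<close>

record ('z, 'x) inj_functor =
  obj :: "'z set \<Rightarrow> 'x set"
  arr :: "'z set \<Rightarrow> 'z set \<Rightarrow> ('z \<Rightarrow> 'z) \<Rightarrow> 'x \<Rightarrow> 'x"

definition is_inj_functor :: "('z, 'x) inj_functor \<Rightarrow> bool" where
  "is_inj_functor F \<longleftrightarrow>
     (\<forall>Z W. \<forall>f\<in>inj_hom Z W. arr F Z W f \<in> inj_hom (obj F Z) (obj F W)) \<and>
     (\<forall>Z. arr F Z Z (\<lambda>z\<in>Z. z) = (\<lambda>x\<in>obj F Z. x)) \<and>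
     (\<forall>Y Z W. \<forall>f\<in>inj_hom Y Z. \<forall>g\<in>inj_hom Z W.
        arr F Y W (compose Y g f) = compose (obj F Y) (arr F Z W g) (arr F Y Z f))"

definition natural_transformation ::
  "('z, 'x) inj_functor \<Rightarrow> ('z, 'y) inj_functor \<Rightarrow> ('z set \<Rightarrow> 'x \<Rightarrow> 'y) \<Rightarrow> bool" where
  "natural_transformation F F' \<eta> \<longleftrightarrow>
     (\<forall>Z. \<eta> Z \<in> inj_hom (obj F Z) (obj F' Z)) \<and>
     (\<forall>Z W. \<forall>f\<in>inj_hom Z W.
        compose (obj F Z) (\<eta> W) (arr F Z W f) = compose (obj F Z) (arr F' Z W f) (\<eta> Z))"

definition naturally_isomorphic ::
  "('z, 'x) inj_functor \<Rightarrow> ('z, 'y) inj_functor \<Rightarrow> bool" where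
  "naturally_isomorphic F F' \<longleftrightarrow>
     (\<exists>\<eta> \<theta>. natural_transformation F F' \<eta> \<and> natural_transformation F' F \<theta> \<and>
        (\<forall>Z. compose (obj F Z) (\<theta> Z) (\<eta> Z) = (\<lambda>x\<in>obj F Z. x) \<and>
             compose (obj F' Z) (\<eta> Z) (\<theta> Z) = (\<lambda>y\<in>obj F' Z. y)))"

definition chromatic_functor :: "'v graph \<Rightarrow> ('z, 'v \<Rightarrow> 'z) inj_functor" where
  "chromatic_functor G =
     \<lparr>obj = colorings G,
      arr = (\<lambda>Z W f. \<lambda>c\<in>colorings G Z. compose (verts G) f c)\<rparr>"

lemma is_inj_functor_chromatic_functor:
  fixes G :: "'v graph"
  assumes "simple_graph G"
  shows "is_inj_functor (chromatic_functor G :: ('z, 'v \<Rightarrow> 'z) inj_functor)"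
proof -
  let ?F = "chromatic_functor G :: ('z, 'v \<Rightarrow> 'z) inj_functor"
  have push: "compose (verts G) f c \<in> colorings G W"
    if f: "f \<in> inj_hom Z W" and c: "c \<in> colorings G Z" for Z W :: "'z set" and f c
  proof -
    have "f (c v1) \<noteq> f (c v2)" if e: "{v1, v2} \<in> edges G" for v1 v2
    proof -
      have "v1 \<in> verts G" "v2 \<in> verts G" using e assms by (auto simp: simple_graph_def)
      then have "c v1 \<in> Z" "c v2 \<in> Z" "c v1 \<noteq> c v2" using c e by (auto simp: colorings_def)
      then show ?thesis using f by (auto simp: inj_hom_def inj_on_def)
    qed
    then show ?thesis using f c assms
      by (auto simp: colorings_def compose_def inj_hom_def simple_graph_def)
  qed
  have inj: "c = d"
    if f: "f \<in> inj_hom Z W" and cd: "c \<in> colorings G Z" "d \<in> colorings G Z"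
      and eq: "compose (verts G) f c = compose (verts G) f d" for Z W :: "'z set" and f c d
  proof (rule PiE_ext[of _ "verts G" "\<lambda>_. Z"])
    show "c \<in> verts G \<rightarrow>\<^sub>E Z" "d \<in> verts G \<rightarrow>\<^sub>E Z" using cd by (auto simp: colorings_def)
    fix v assume v: "v \<in> verts G"
    then have "f (c v) = f (d v)" using fun_cong[OF eq, of v] by (simp add: compose_def)
    moreover have "c v \<in> Z" "d v \<in> Z" using v cd by (auto simp: colorings_def)
    ultimately show "c v = d v" using f by (auto simp: inj_hom_def inj_on_def)
  qed
  have ident: "compose (verts G) (\<lambda>z\<in>Z. z) c = c" if "c \<in> colorings G Z" for Z :: "'z set" and c
    using that by (intro ext) (auto simp: colorings_def compose_def PiE_def extensional_def)
  have comp: "compose (verts G) (compose Y g f) c = compose (verts G) g (compose (verts G) f c)"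
    if "c \<in> colorings G Y" for Y :: "'z set" and f g :: "'z \<Rightarrow> 'z" and c
    using that by (intro ext) (auto simp: colorings_def compose_def)
  show ?thesis
    unfolding is_inj_functor_def
  proof (intro conjI allI ballI)
    fix Z W :: "'z set" and f assume f: "f \<in> inj_hom Z W"
    then show "arr ?F Z W f
        \<in> inj_hom (obj ?F Z) (obj ?F W)"
      using push[OF f] inj[OF f]
      by (auto simp: chromatic_functor_def inj_hom_def[of "colorings G Z"] intro!: inj_onI)
  next
    fix Z :: "'z set"
    show "arr ?F Z Z (\<lambda>z\<in>Z. z) = (\<lambda>x\<in>obj ?F Z. x)"
      using ident by (intro ext) (auto simp: chromatic_functor_def)
  next
    fix Y Z W :: "'z set" and f g assume f: "f \<in> inj_hom Y Z" and g: "g \<in> inj_hom Z W"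
    then show "arr ?F Y W (compose Y g f) =
        compose (obj ?F Y)
          (arr ?F Z W g) (arr ?F Y Z f)"
      using push[OF f] comp
      by (intro ext) (auto simp: chromatic_functor_def compose_def[of "colorings G Y"])
  qed
qed

text \<open>Here too the sets considered are the subsets of \<open>'z\<close>, so \<open>'z\<close> is an explicit parameter.
  If \<open>'z\<close> admits no colouring of either graph, both functors are constantly empty and hence
  isomorphic; statements of non-equivalence therefore need \<open>'z\<close> to be large enough.\<close>

definition chromatically_equivalent :: "'z itself \<Rightarrow> 'v graph \<Rightarrow> 'w graph \<Rightarrow> bool" where
  "chromatically_equivalent TYPE('z) G H \<longleftrightarrow>
     naturally_isomorphic (chromatic_functor G :: ('z, 'v \<Rightarrow> 'z) inj_functor)
                          (chromatic_functor H :: ('z, 'w \<Rightarrow> 'z) inj_functor)"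

end

(* The point of non-equivalence: a colouring factors through a subset of the colours exactly when
   its range lies in that subset, so a natural isomorphism preserves ranges. The colourings of K_X
   with range all of Z are the bijections from X to Z, and Sym(Z) permutes them transitively. But
   K_X' has both an injective and a non-injective colouring with range Z, and these lie in different
   Sym(Z)-orbits. *)
theory Submission
  imports Defs
begin

lemma verts_complete_graph [simp]: "verts (complete_graph X) = X"
  by (simp add: complete_graph_def)

lemma verts_delete_edge [simp]: "verts (delete_edge G e) = verts G"
  by (simp add: delete_edge_def)

lemma edges_complete_graph_iff:
  "{v, w} \<in> edges (complete_graph X) \<longleftrightarrow> v \<in> X \<and> w \<in> X \<and> v \<noteq> w"
  by (auto simp: complete_graph_def card_insert_if)

lemma colorings_complete_graph: "colorings (complete_graph X) Z = inj_hom X Z"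
  unfolding colorings_def inj_hom_def inj_on_def
  by (auto simp: edges_complete_graph_iff)

lemma colorings_complete_graph_delete_edge:
  assumes "x0 \<noteq> x1"
  shows "colorings (delete_edge (complete_graph X) {x0, x1}) Z =
    {c \<in> X \<rightarrow>\<^sub>E Z. inj_on c (X - {x0}) \<and> inj_on c (X - {x1})}"
proof -
  have edges: "{v, w} \<in> edges (delete_edge (complete_graph X) {x0, x1}) \<longleftrightarrow>
      v \<in> X \<and> w \<in> X \<and> v \<noteq> w \<and> {v, w} \<noteq> {x0, x1}" for v w
    using edges_complete_graph_iff[of v w X] by (auto simp: delete_edge_def)
  show ?thesis
    unfolding colorings_def inj_on_def edges verts_delete_edge verts_complete_graph
    using assms unfolding doubleton_eq_iff by (intro Collect_cong) blast
qed

lemma colorings_delete_edge_mono: "colorings G Z \<subseteq> colorings (delete_edge G e) Z"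
  by (auto simp: colorings_def delete_edge_def)

lemma inj_hom_nonempty:
  assumes "|A| \<le>o |B|"
  shows "inj_hom A B \<noteq> {}"
proof -
  obtain f where "inj_on f A" "f ` A \<subseteq> B"
    using assms by (auto simp: card_of_ordLeq[symmetric])
  then have "restrict f A \<in> inj_hom A B"
    by (auto simp: inj_hom_def inj_on_def)
  then show ?thesis by blast
qed

lemma chromatic_number_eq_card_verts:
  fixes G :: "'v graph"
  assumes univ: "|verts G| \<le>o |UNIV :: 'z set|"
    and ex: "\<And>Z :: 'z set. |verts G| \<le>o |Z| \<Longrightarrow> colorings G Z \<noteq> {}"
    and lower: "\<And>Z :: 'z set. colorings G Z \<noteq> {} \<Longrightarrow> |verts G| \<le>o |Z|"
  shows "chromatic_number TYPE('z) G =o |verts G|"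
proof -
  obtain Y :: "'z set" where Y: "|verts G| =o |Y|"
    using univ unfolding internalize_card_of_ordLeq2[of "verts G"] by auto
  obtain Z :: "'z set" where Z: "chromatic_number TYPE('z) G = |Z|" "colorings G Z \<noteq> {}"
      "\<forall>W :: 'z set. colorings G W \<noteq> {} \<longrightarrow> |Z| \<le>o |W|"
    using chromatic_number_attained[OF ex[OF univ]] by blast
  have "|Z| \<le>o |Y|"
    using Z(3) ex[OF ordIso_imp_ordLeq[OF Y]] by blast
  then have "|Z| \<le>o |verts G|"
    using ordIso_symmetric[OF Y] by (rule ordLeq_ordIso_trans)
  then show ?thesis
    using lower[OF Z(2)] Z(1) by (simp add: ordIso_iff_ordLeq)
qed

lemma card_of_PiE_self_le:
  assumes "infinite X"
  shows "|X \<rightarrow>\<^sub>E X| \<le>o ctwo ^c |X|"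
proof -
  have X: "Cinfinite |X|"
    using assms by (simp add: cinfinite_def card_of_card_order_on Field_card_of)
  have "X \<rightarrow>\<^sub>E X = Func X X"
    by (auto simp: Func_def PiE_def extensional_def Pi_def)
  then have "|X \<rightarrow>\<^sub>E X| =o |X| ^c |X|"
    by (simp add: cexp_def Field_card_of card_of_refl)
  also have "|X| ^c |X| \<le>o (ctwo ^c |X| ) ^c |X|"
    by (intro cexp_mono1 ordLess_imp_ordLeq ordLess_ctwo_cexp card_of_Card_order)
  also have "(ctwo ^c |X| ) ^c |X| =o ctwo ^c ( |X| *c |X| )"
    by (rule cexp_cprod[OF Card_order_ctwo])
  also have "ctwo ^c ( |X| *c |X| ) =o ctwo ^c |X|"
    by (rule cexp_cong2[OF cprod_infinite[OF X] Card_order_ctwo])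
      (simp_all add: card_of_Card_order Card_order_cprod)
  finally show ?thesis .
qed

lemma card_of_inj_hom_self_ge:
  assumes "infinite X"
  shows "ctwo ^c |X| \<le>o |inj_hom X X|"
proof -
  have "|UNIV :: bool set| \<le>o |X|"
    using assms by (intro ordLess_imp_ordLeq card_of_Well_order[THEN finite_ordLess_infinite])
      (auto simp: card_of_well_order_on Field_card_of)
  then have "|X \<times> (UNIV :: bool set)| \<le>o |X|"
    using assms by (simp add: ordIso_imp_ordLeq card_of_Times_infinite)
  then obtain h :: "'a \<times> bool \<Rightarrow> 'a" where h: "inj_on h (X \<times> UNIV)" "h ` (X \<times> UNIV) \<subseteq> X"
    by (auto simp: card_of_ordLeq[symmetric])
  define code where "code s = (\<lambda>x\<in>X. h (x, s x))" for s
  have "inj_on code (Func X UNIV)"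
  proof (rule inj_onI, rule ext)
    fix s t :: "'a \<Rightarrow> bool" and x
    assume st: "s \<in> Func X UNIV" "t \<in> Func X UNIV" "code s = code t"
    show "s x = t x"
    proof (cases "x \<in> X")
      case True
      then show ?thesis
        using fun_cong[OF st(3), of x] h(1) by (auto simp: code_def dest: inj_onD)
    next
      case False
      then show ?thesis using st by (auto simp: Func_def)
    qed
  qed
  moreover have "code ` Func X UNIV \<subseteq> inj_hom X X"
    using h by (auto simp: code_def inj_hom_def inj_on_def)
  ultimately have "|Func X (UNIV :: bool set)| \<le>o |inj_hom X X|"
    by (auto simp: card_of_ordLeq[symmetric])
  then show ?thesis
    by (simp add: cexp_def ctwo_def Field_card_of)
qed

lemma natural_transformation_chromatic:
  fixes G :: "'v graph" and H :: "'w graph" and Z W :: "'z set"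
  assumes \<eta>: "natural_transformation (chromatic_functor G) (chromatic_functor H) \<eta>"
    and c: "c \<in> colorings G Z"
  shows "\<eta> Z c \<in> colorings H Z"
    and "f \<in> inj_hom Z W \<Longrightarrow> \<eta> W (compose (verts G) f c) = compose (verts H) f (\<eta> Z c)"
proof -
  show mem: "\<eta> Z c \<in> colorings H Z"
    using \<eta> c by (auto simp: natural_transformation_def chromatic_functor_def inj_hom_def)
  assume "f \<in> inj_hom Z W"
  then have "compose (colorings G Z) (\<eta> W) (\<lambda>c\<in>colorings G Z. compose (verts G) f c) =
      compose (colorings G Z) (\<lambda>c\<in>colorings H Z. compose (verts H) f c) (\<eta> Z)"
    using \<eta> by (auto simp: natural_transformation_def chromatic_functor_def)
  from fun_cong[OF this, of c]
  show "\<eta> W (compose (verts G) f c) = compose (verts H) f (\<eta> Z c)"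
    using c mem by (simp add: compose_def)
qed

lemma natural_transformation_chromatic_range:
  fixes G :: "'v graph" and H :: "'w graph" and Z :: "'z set"
  assumes \<eta>: "natural_transformation (chromatic_functor G) (chromatic_functor H) \<eta>"
    and c: "c \<in> colorings G Z"
  shows "\<eta> Z c ` verts H \<subseteq> c ` verts G"
proof -
  let ?Y = "c ` verts G"
  have Y: "?Y \<subseteq> Z" and cY: "c \<in> colorings G ?Y"
    using c by (auto simp: colorings_def PiE_def)
  have incl: "(\<lambda>y\<in>?Y. y) \<in> inj_hom ?Y Z"
    using Y by (auto simp: inj_hom_def inj_on_def)
  have "compose (verts G) (\<lambda>y\<in>?Y. y) c = c"
    using c by (intro ext) (auto simp: colorings_def compose_def PiE_def extensional_def)
  then have "\<eta> Z c = compose (verts H) (\<lambda>y\<in>?Y. y) (\<eta> ?Y c)"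
    using natural_transformation_chromatic(2)[OF \<eta> cY incl] by simp
  moreover have "\<eta> ?Y c \<in> verts H \<rightarrow>\<^sub>E ?Y"
    using natural_transformation_chromatic(1)[OF \<eta> cY] by (simp add: colorings_def)
  ultimately show ?thesis
    by (auto simp: compose_def PiE_mem)
qed

lemma not_chromatically_equivalent_complete_graph:
  fixes X :: "'a set" and H :: "'b graph" and Z :: "'z set"
  assumes d: "d \<in> colorings H Z" "d ` verts H = Z" "inj_on d (verts H)"
    and d': "d' \<in> colorings H Z" "d' ` verts H = Z" "\<not> inj_on d' (verts H)"
  shows "\<not> chromatically_equivalent TYPE('z) (complete_graph X) H"
proof
  let ?K = "complete_graph X"
  assume "chromatically_equivalent TYPE('z) ?K H"
  then obtain \<eta> :: "'z set \<Rightarrow> ('a \<Rightarrow> 'z) \<Rightarrow> 'b \<Rightarrow> 'z" and \<theta> where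
    \<eta>: "natural_transformation (chromatic_functor ?K) (chromatic_functor H) \<eta>" and
    \<theta>: "natural_transformation (chromatic_functor H) (chromatic_functor ?K) \<theta>" and
    inv: "\<And>Z. compose (colorings H Z) (\<eta> Z) (\<theta> Z) = (\<lambda>y\<in>colorings H Z. y)"
    by (auto simp: chromatically_equivalent_def naturally_isomorphic_def chromatic_functor_def)
  have \<eta>\<theta>: "\<eta> Z (\<theta> Z e) = e" if "e \<in> colorings H Z" for e
    using fun_cong[OF inv[of Z], of e] that by (simp add: compose_def)
  have bij: "\<theta> Z e \<in> X \<rightarrow>\<^sub>E Z" "bij_betw (\<theta> Z e) X Z"
    if e: "e \<in> colorings H Z" "e ` verts H = Z" for e
  proof -
    have mem: "\<theta> Z e \<in> colorings ?K Z"
      using natural_transformation_chromatic(1)[OF \<theta> e(1)] .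
    show ext: "\<theta> Z e \<in> X \<rightarrow>\<^sub>E Z"
      using mem by (simp add: colorings_complete_graph inj_hom_def)
    have "Z \<subseteq> \<theta> Z e ` X"
      using natural_transformation_chromatic_range[OF \<eta> mem] \<eta>\<theta>[OF e(1)] e(2) by simp
    then show "bij_betw (\<theta> Z e) X Z"
      using mem ext by (auto simp: colorings_complete_graph inj_hom_def bij_betw_def)
  qed
  define \<sigma> where "\<sigma> = (\<lambda>z\<in>Z. \<theta> Z d' (inv_into X (\<theta> Z d) z))"
  have "bij_betw (\<theta> Z d' \<circ> inv_into X (\<theta> Z d)) Z Z"
    using bij[OF d(1,2)] bij[OF d'(1,2)] bij_betw_inv_into bij_betw_trans by blast
  then have \<sigma>: "\<sigma> \<in> inj_hom Z Z"
    by (auto simp: \<sigma>_def inj_hom_def bij_betw_def inj_on_def)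
  have "compose X \<sigma> (\<theta> Z d) = \<theta> Z d'"
  proof
    fix x
    show "compose X \<sigma> (\<theta> Z d) x = \<theta> Z d' x"
      using bij[OF d(1,2)] bij(1)[OF d'(1,2)]
      by (cases "x \<in> X") (auto simp: compose_def \<sigma>_def bij_betw_def)
  qed
  then have "d' = compose (verts H) \<sigma> d"
    using natural_transformation_chromatic(2)[OF \<eta> natural_transformation_chromatic(1)[OF \<theta> d(1)] \<sigma>]
      \<eta>\<theta>[OF d(1)] \<eta>\<theta>[OF d'(1)] by simp
  moreover have "inj_on (compose (verts H) \<sigma> d) (verts H)"
    using \<sigma> d by (auto simp: inj_hom_def inj_on_def compose_def)
  ultimately show False
    using d'(3) by simp
qed

theorem mainTheorem6:
  fixes X :: "'a set" and x0 x1 :: 'a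
  assumes "infinite X"
    and "{x0, x1} \<in> edges (complete_graph X)"
    and "|X| \<le>o |UNIV :: 'z set|"
  shows "(chromatic_number TYPE('z) (complete_graph X) =o |X| \<and>
          chromatic_number TYPE('z) (delete_edge (complete_graph X) {x0, x1}) =o |X| ) \<and>
         ( |colorings (complete_graph X) X| =o ctwo ^c |X| \<and>
          |colorings (delete_edge (complete_graph X) {x0, x1}) X| =o ctwo ^c |X| ) \<and>
         \<not> chromatically_equivalent TYPE('z)
            (complete_graph X) (delete_edge (complete_graph X) {x0, x1})"
proof -
  let ?K = "complete_graph X"
  let ?K' = "delete_edge ?K {x0, x1}"
  have x: "x0 \<in> X" "x1 \<in> X" "x0 \<noteq> x1"
    using assms(2) by (auto simp: edges_complete_graph_iff)
  have minus: "|X| =o |X - {x0}|"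
    using assms(1) by (metis infinite_imp_bij_betw card_of_ordIso)
  have sub: "colorings ?K Z \<subseteq> colorings ?K' Z" for Z :: "'y set"
    by (rule colorings_delete_edge_mono)
  note col' = colorings_complete_graph_delete_edge[OF x(3)]
  have ex: "colorings ?K Z \<noteq> {}" if "|X| \<le>o |Z|" for Z :: "'z set"
    using inj_hom_nonempty[OF that] by (simp add: colorings_complete_graph)
  have lower: "|X| \<le>o |Z|" if ne: "colorings ?K' Z \<noteq> {}" for Z :: "'z set"
  proof -
    obtain c where "c \<in> X \<rightarrow>\<^sub>E Z" "inj_on c (X - {x0})"
      using ne by (auto simp: col')
    then have "|X - {x0}| \<le>o |Z|"
      by (auto simp: card_of_ordLeq[symmetric] intro!: exI[of _ c])
    then show ?thesis
      using minus ordIso_ordLeq_trans by blast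
  qed
  have "chromatic_number TYPE('z) ?K =o |verts ?K|"
    using assms(3) ex lower sub by (intro chromatic_number_eq_card_verts) (simp, simp, force)
  moreover have "chromatic_number TYPE('z) ?K' =o |verts ?K'|"
    using assms(3) ex lower sub by (intro chromatic_number_eq_card_verts) (simp, force, simp)
  moreover have "|colorings ?K X| =o ctwo ^c |X| \<and> |colorings ?K' X| =o ctwo ^c |X|"
  proof -
    have ge: "ctwo ^c |X| \<le>o |colorings ?K X|"
      using card_of_inj_hom_self_ge[OF assms(1)] by (simp add: colorings_complete_graph)
    have mid: "|colorings ?K X| \<le>o |colorings ?K' X|"
      using sub by (rule card_of_mono1)
    have "|colorings ?K' X| \<le>o |X \<rightarrow>\<^sub>E X|"
      by (rule card_of_mono1) (auto simp: col')
    then have le: "|colorings ?K' X| \<le>o ctwo ^c |X|"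
      using card_of_PiE_self_le[OF assms(1)] ordLeq_transitive by blast
    show ?thesis
      using ordLeq_transitive[OF mid le] ordLeq_transitive[OF ge mid] ge le
      by (simp add: ordIso_iff_ordLeq)
  qed
  moreover have "\<not> chromatically_equivalent TYPE('z) ?K ?K'"
  proof -
    obtain f :: "'a \<Rightarrow> 'z" where f: "inj_on f X"
      using assms(3) by (auto simp: card_of_ordLeq[symmetric])
    obtain g where g: "bij_betw g (X - {x0}) X"
      using minus card_of_ordIso ordIso_symmetric by blast
    let ?d = "restrict f X"
    let ?d' = "\<lambda>x\<in>X. f (g (if x = x0 then x1 else x))"
    have gX: "g x \<in> X" if "x \<in> X" "x \<noteq> x0" for x
      using g that by (auto simp: bij_betw_def)
    have fg: "f (g u) = f (g v) \<longleftrightarrow> u = v" if "u \<in> X - {x0}" "v \<in> X - {x0}" for u v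
      using f g gX that by (auto simp: bij_betw_def inj_on_def)
    have "?d \<in> colorings ?K' (f ` X)"
      using f by (auto simp: col' inj_on_def)
    moreover have "?d ` X = f ` X" "inj_on ?d X"
      using f by (auto simp: inj_on_def)
    moreover have "?d' \<in> colorings ?K' (f ` X)"
      using x gX fg by (auto simp: col' inj_on_def)
    moreover have "?d' ` X = f ` X"
    proof
      show "?d' ` X \<subseteq> f ` X"
        using x gX by auto
      have "f ` X = (\<lambda>u. f (g u)) ` (X - {x0})"
        using g by (auto simp: bij_betw_def image_image[symmetric, of f g])
      also have "\<dots> = ?d' ` (X - {x0})"
        by (rule image_cong) auto
      finally show "f ` X \<subseteq> ?d' ` X"
        by blast
    qed
    moreover have "\<not> inj_on ?d' X"
      using x inj_onD[of ?d' X x0 x1] by auto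
    ultimately show ?thesis
      by (intro not_chromatically_equivalent_complete_graph[of ?d _ "f ` X" ?d']) simp_all
  qed
  ultimately show ?thesis
    by simp
qed

end
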